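(* The class $\mathcal K_\omega$ of all countable ordered linear orders $(L,<,\lhd)$ has the automorphic Borel amalgamation property (ABAP).
   Context: An ordered linear order is a structure $(L,<,\lhd)$ where $<$ and $\lhd$ are both (strict) linear orders on $L$, with no further relation required between them. ABAP. Let $\mathcal K_\omega$ be a class of countable relational structures in a fixed countable relational language, closed under isomorphism; it is regarded as a standard Borel space in the usual way (coding structures with universe a subset of $\mathbb N$). For $A\in\mathcal K_\omega$, a quantifier-free type $\tau(x)$ in one free variable with finitely many parameters from $A$ is an admissible finite type over $A$ if there is $B\in\mathcal K_\omega$ with $A$ a substructure of $B$ and $B$ containing an element realizing $\tau$. The class $\mathcal K_\omega$ has the ABAP if there is a Borel map $E$ on $\mathcal K_\omega$ such that: (a) for every $A\in\mathcal K_\omega$, $E(A)\in\mathcal K_\omega$ is an extension of $A$ containing witnesses for all admissible finite types over $A$; (b) there is a Borel assignment $(A,\phi)\mapsto\tilde\phi$, from pairs with $A\in\mathcal K_\omega$ and $\phi\in\mathrm{Aut}(A)$, to $\tilde\phi\in\mathrm{Aut}(E(A))$ such that $\phi\subseteq\tilde\phi$ and $\tilde\phi$ has no fixed points in $E(A)\setminus A$; (c) there is an assignment $(A_0,A_1,\alpha)\mapsto\hat\alpha$, from triples with $A_i\in\mathcal K_\omega$ and $\alpha\colon A_0\cong A_1$ an isomorphism, to isomorphisms $\hat\alpha\colon E(A_0)\cong E(A_1)$ extending $\alpha$, such that whenever $\phi_i\in\mathrm{Aut}(A_i)$ and $\alpha\phi_0=\phi_1\alpha$, we have $\hat\alpha\tilde\phi_0=\tilde\phi_1\hat\alpha$.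 *)

theory Defs
  imports "HOL-Analysis.Analysis"
begin

text \<open>Makes the Borel structure of a countable product of copies of \<open>bool\<close> the product one.\<close>

instance bool :: second_countable_topology
proof
  have "open = generate_topology (UNIV :: bool set set)"
    by (auto simp: fun_eq_iff open_discrete intro: generate_topology.Basis)
  then show "\<exists>B :: bool set set. countable B \<and> open = generate_topology B"
    by (intro exI[of _ UNIV]) simp
qed

text \<open>Relational structures with universe a subset of the natural numbers. A relation symbol
  \<open>r\<close> is interpreted by a set of lists (of length \<open>ar r\<close>, see \<open>structures\<close>), and all sets are
  given by their characteristic functions, so that the topology on codes is the product topology
  of copies of the discrete space \<open>bool\<close> and \<open>borel\<close> is the usual Borel structure.\<close>

type_synonym 'r struc = "(nat \<Rightarrow> bool) \<times> ('r \<Rightarrow> nat list \<Rightarrow> bool)"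

definition univ :: "'r struc \<Rightarrow> nat set" where
  "univ A = {n. fst A n}"

definition rel :: "'r struc \<Rightarrow> 'r \<Rightarrow> nat list \<Rightarrow> bool" where
  "rel A = snd A"

definition structures :: "('r \<Rightarrow> nat) \<Rightarrow> 'r struc set" where
  "structures ar = {A. \<forall>r xs. rel A r xs \<longrightarrow> length xs = ar r \<and> set xs \<subseteq> univ A}"

text \<open>Maps between universes are functions on the natural numbers that are \<open>undefined\<close> off
  their domain, so each map has exactly one code, a point of the Baire space.\<close>

definition embeddings :: "'r struc \<Rightarrow> 'r struc \<Rightarrow> (nat \<Rightarrow> nat) set" where
  "embeddings A B = {f \<in> univ A \<rightarrow>\<^sub>E univ B. inj_on f (univ A) \<and>
     (\<forall>r xs. set xs \<subseteq> univ A \<longrightarrow> (rel A r xs \<longleftrightarrow> rel B r (map f xs)))}"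

definition isos :: "'r struc \<Rightarrow> 'r struc \<Rightarrow> (nat \<Rightarrow> nat) set" where
  "isos A B = {f \<in> embeddings A B. f ` univ A = univ B}"

abbreviation auts :: "'r struc \<Rightarrow> (nat \<Rightarrow> nat) set" where
  "auts A \<equiv> isos A A"

definition iso_closed :: "('r \<Rightarrow> nat) \<Rightarrow> 'r struc set \<Rightarrow> bool" where
  "iso_closed ar K \<longleftrightarrow>
     (\<forall>A\<in>K. \<forall>B\<in>structures ar. isos A B \<noteq> {} \<longrightarrow> B \<in> K)"

text \<open>Quantifier-free formulas in the single free variable \<open>X\<close>, with parameters from the
  universe of a structure.\<close>

datatype qf_term = X | Param nat

datatype 'r qf_formula =
    Eq qf_term qf_term
  | Atom 'r "qf_term list"
  | Neg "'r qf_formula"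
  | Conj "'r qf_formula" "'r qf_formula"

fun term_over :: "nat set \<Rightarrow> qf_term \<Rightarrow> bool" where
  "term_over F X \<longleftrightarrow> True"
| "term_over F (Param a) \<longleftrightarrow> a \<in> F"

fun formula_over :: "('r \<Rightarrow> nat) \<Rightarrow> nat set \<Rightarrow> 'r qf_formula \<Rightarrow> bool" where
  "formula_over ar F (Eq s t) \<longleftrightarrow> term_over F s \<and> term_over F t"
| "formula_over ar F (Atom r ts) \<longleftrightarrow> length ts = ar r \<and> (\<forall>t\<in>set ts. term_over F t)"
| "formula_over ar F (Neg p) \<longleftrightarrow> formula_over ar F p"
| "formula_over ar F (Conj p q) \<longleftrightarrow> formula_over ar F p \<and> formula_over ar F q"

text \<open>Satisfaction by \<open>b\<close> in \<open>B\<close> of a formula with parameters in \<open>A\<close>, where \<open>A\<close> is regarded as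
  a substructure of \<open>B\<close> via the embedding \<open>j\<close>.\<close>

fun eval_term :: "(nat \<Rightarrow> nat) \<Rightarrow> nat \<Rightarrow> qf_term \<Rightarrow> nat" where
  "eval_term j b X = b"
| "eval_term j b (Param a) = j a"

fun sat :: "'r struc \<Rightarrow> (nat \<Rightarrow> nat) \<Rightarrow> nat \<Rightarrow> 'r qf_formula \<Rightarrow> bool" where
  "sat B j b (Eq s t) \<longleftrightarrow> eval_term j b s = eval_term j b t"
| "sat B j b (Atom r ts) \<longleftrightarrow> rel B r (map (eval_term j b) ts)"
| "sat B j b (Neg p) \<longleftrightarrow> \<not> sat B j b p"
| "sat B j b (Conj p q) \<longleftrightarrow> sat B j b p \<and> sat B j b q"

definition realized :: "'r struc \<Rightarrow> (nat \<Rightarrow> nat) \<Rightarrow> 'r qf_formula set \<Rightarrow> bool" where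
  "realized B j \<tau> \<longleftrightarrow> (\<exists>b\<in>univ B. \<forall>p\<in>\<tau>. sat B j b p)"

text \<open>A type may be partial or complete; the parameters occurring in all of its formulas
  together form a finite set.\<close>

definition finite_types :: "('r \<Rightarrow> nat) \<Rightarrow> 'r struc \<Rightarrow> 'r qf_formula set set" where
  "finite_types ar A = {\<tau>. \<exists>F. finite F \<and> F \<subseteq> univ A \<and> (\<forall>p\<in>\<tau>. formula_over ar F p)}"

definition admissible_types ::
    "('r \<Rightarrow> nat) \<Rightarrow> 'r struc set \<Rightarrow> 'r struc \<Rightarrow> 'r qf_formula set set" where
  "admissible_types ar K A =
     {\<tau> \<in> finite_types ar A. \<exists>B\<in>K. \<exists>j\<in>embeddings A B. realized B j \<tau>}"

text \<open>A structure whose universe is all of \<open>\<nat>\<close> has no literal proper extension with universe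
  a subset of \<open>\<nat>\<close>, so an extension of \<open>A\<close> is a structure together with an embedding of \<open>A\<close> into
  it. The extension map consists of \<open>E\<close> and the inclusion map \<open>\<iota> A\<close> of \<open>A\<close> into \<open>E A\<close>, both Borel
  in \<open>A\<close>.\<close>

definition borel_extension ::
    "('r::countable \<Rightarrow> nat) \<Rightarrow> 'r struc set \<Rightarrow> ('r struc \<Rightarrow> 'r struc) \<Rightarrow>
     ('r struc \<Rightarrow> nat \<Rightarrow> nat) \<Rightarrow> bool" where
  "borel_extension ar K E \<iota> \<longleftrightarrow>
     E \<in> restrict_space borel K \<rightarrow>\<^sub>M borel \<and>
     \<iota> \<in> restrict_space borel K \<rightarrow>\<^sub>M borel \<and>
     (\<forall>A\<in>K. E A \<in> K \<and> \<iota> A \<in> embeddings A (E A) \<and>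
        (\<forall>\<tau>\<in>admissible_types ar K A. realized (E A) (\<iota> A) \<tau>))"

definition borel_aut_extension ::
    "'r::countable struc set \<Rightarrow> ('r struc \<Rightarrow> 'r struc) \<Rightarrow> ('r struc \<Rightarrow> nat \<Rightarrow> nat) \<Rightarrow>
     ('r struc \<Rightarrow> (nat \<Rightarrow> nat) \<Rightarrow> nat \<Rightarrow> nat) \<Rightarrow> bool" where
  "borel_aut_extension K E \<iota> T \<longleftrightarrow>
     (\<lambda>(A, \<phi>). T A \<phi>) \<in> restrict_space borel {(A, \<phi>). A \<in> K \<and> \<phi> \<in> auts A} \<rightarrow>\<^sub>M borel \<and>
     (\<forall>A\<in>K. \<forall>\<phi>\<in>auts A. T A \<phi> \<in> auts (E A) \<and>
        (\<forall>x\<in>univ A. T A \<phi> (\<iota> A x) = \<iota> A (\<phi> x)) \<and>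
        (\<forall>y\<in>univ (E A) - \<iota> A ` univ A. T A \<phi> y \<noteq> y))"

definition equivariant_iso_extension ::
    "'r struc set \<Rightarrow> ('r struc \<Rightarrow> 'r struc) \<Rightarrow> ('r struc \<Rightarrow> nat \<Rightarrow> nat) \<Rightarrow>
     ('r struc \<Rightarrow> (nat \<Rightarrow> nat) \<Rightarrow> nat \<Rightarrow> nat) \<Rightarrow>
     ('r struc \<Rightarrow> 'r struc \<Rightarrow> (nat \<Rightarrow> nat) \<Rightarrow> nat \<Rightarrow> nat) \<Rightarrow> bool" where
  "equivariant_iso_extension K E \<iota> T H \<longleftrightarrow>
     (\<forall>A\<^sub>0\<in>K. \<forall>A\<^sub>1\<in>K. \<forall>\<alpha>\<in>isos A\<^sub>0 A\<^sub>1. H A\<^sub>0 A\<^sub>1 \<alpha> \<in> isos (E A\<^sub>0) (E A\<^sub>1) \<and>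
        (\<forall>x\<in>univ A\<^sub>0. H A\<^sub>0 A\<^sub>1 \<alpha> (\<iota> A\<^sub>0 x) = \<iota> A\<^sub>1 (\<alpha> x)) \<and>
        (\<forall>\<phi>\<^sub>0\<in>auts A\<^sub>0. \<forall>\<phi>\<^sub>1\<in>auts A\<^sub>1. (\<forall>x\<in>univ A\<^sub>0. \<alpha> (\<phi>\<^sub>0 x) = \<phi>\<^sub>1 (\<alpha> x)) \<longrightarrow>
           (\<forall>y\<in>univ (E A\<^sub>0). H A\<^sub>0 A\<^sub>1 \<alpha> (T A\<^sub>0 \<phi>\<^sub>0 y) = T A\<^sub>1 \<phi>\<^sub>1 (H A\<^sub>0 A\<^sub>1 \<alpha> y))))"

text \<open>The automorphic Borel amalgamation property. That \<open>K\<close> is an isomorphism-closed Borel set of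
  codes, hence a standard Borel space, is part of the property.\<close>

definition ABAP :: "('r::countable \<Rightarrow> nat) \<Rightarrow> 'r struc set \<Rightarrow> bool" where
  "ABAP ar K \<longleftrightarrow>
     K \<subseteq> structures ar \<and> iso_closed ar K \<and> K \<in> sets borel \<and>
     (\<exists>E \<iota>. borel_extension ar K E \<iota> \<and>
        (\<exists>T. borel_aut_extension K E \<iota> T \<and>
           (\<exists>H. equivariant_iso_extension K E \<iota> T H)))"

datatype olo_symbol = Less | Tri

instance olo_symbol :: countable
  by countable_datatype

definition olo_arity :: "olo_symbol \<Rightarrow> nat" where
  "olo_arity r = 2"

definition ordered_linear_orders :: "olo_symbol struc set" where
  "ordered_linear_orders =
     {L \<in> structures olo_arity.
        strict_linear_order_on (univ L) {(x, y). rel L Less [x, y]} \<and>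
        strict_linear_order_on (univ L) {(x, y). rel L Tri [x, y]}}"

end

theory Submission
  imports Defs
begin

text \<open>Let \<open>A\<close> be an ordered linear order. A cut of \<open>A\<close> is given by an element of \<open>A option\<close>:
  \<open>None\<close> is the cut below all of \<open>A\<close>, and \<open>Some a\<close> is the cut immediately above \<open>a\<close>. The
  extension \<open>E A\<close> adds, for all pairs \<open>(c, d)\<close> of cuts (\<open>c\<close> with respect to \<open><\<close> and \<open>d\<close> with
  respect to \<open>\<lhd>\<close>), a copy of \<open>\<int>\<close> that fills both cuts; points in the same cut with respect to one
  order are compared by their cuts in the other order first. Every finite type is realized by an
  element of \<open>A\<close> or by a new point \<open>(c, d, 0)\<close>. The construction is functorial, and the shift
  \<open>(c, d, n) \<mapsto> (c, d, n + 1)\<close> is an automorphism of \<open>E A\<close> which moves exactly the new points and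
  commutes with all maps induced by isomorphisms. So \<open>\<phi>\<close> is extended by the induced map followed
  by the shift, and \<open>\<alpha>\<close> is extended by the induced map.\<close>

section \<open>Points of the extension and the order on them\<close>

type_synonym 'a ext_point = "'a + 'a option \<times> 'a option \<times> int"

text \<open>The elements of \<open>A\<close> that a point mentions. A point belongs to the extension
  of \<open>A\<close> exactly when its support lies in the universe, so one type of points serves
  all structures.\<close>

fun support :: "'a ext_point \<Rightarrow> 'a set" where
  "support (Inl a) = {a}"
| "support (Inr (c, d, n)) = set_option c \<union> set_option d"

text \<open>The functorial action of \<open>f\<close> combined with a shift by \<open>k\<close>:
  \<open>k = 0\<close> gives the map induced by an isomorphism, \<open>k = 1\<close> the
  fixed-point-free extension of an automorphism.\<close>

fun move :: "('a \<Rightarrow> 'b) \<Rightarrow> int \<Rightarrow> 'a ext_point \<Rightarrow> 'b ext_point" where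
  "move f k (Inl a) = Inl (f a)"
| "move f k (Inr (c, d, n)) = Inr (map_option f c, map_option f d, n + k)"

text \<open>The order of the cuts, with \<open>None\<close> least. For irreflexive \<open>R\<close>,
  \<open>cut_less R c (Some a)\<close> also says that a point filling \<open>c\<close> lies below
  \<open>a\<close> itself, since \<open>Some a\<close> is the first cut above
  \<open>a\<close>.\<close>

fun cut_less :: "('a \<Rightarrow> 'a \<Rightarrow> bool) \<Rightarrow> 'a option \<Rightarrow> 'a option \<Rightarrow> bool" where
  "cut_less R c None \<longleftrightarrow> False"
| "cut_less R None (Some b) \<longleftrightarrow> True"
| "cut_less R (Some a) (Some b) \<longleftrightarrow> R a b"

text \<open>An old point \<open>a\<close> sits just below the cut \<open>Some a\<close>. Hence it is
  compared weakly with a cut when it is on the left and strictly when it is on the right. Ties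
  between new points are broken by the other cut and then by the integer.\<close>

fun ext_less :: "('a \<Rightarrow> 'a \<Rightarrow> bool) \<Rightarrow> ('a \<Rightarrow> 'a \<Rightarrow> bool) \<Rightarrow> 'a ext_point \<Rightarrow> 'a ext_point \<Rightarrow> bool"
where
  "ext_less R S (Inl a) (Inl b) \<longleftrightarrow> R a b"
| "ext_less R S (Inl a) (Inr (c, d, n)) \<longleftrightarrow> Some a = c \<or> cut_less R (Some a) c"
| "ext_less R S (Inr (c, d, n)) (Inl a) \<longleftrightarrow> cut_less R c (Some a)"
| "ext_less R S (Inr (c, d, n)) (Inr (c', d', n')) \<longleftrightarrow>
     cut_less R c c' \<or> c = c' \<and> (cut_less S d d' \<or> d = d' \<and> n < n')"

text \<open>The second order is \<open>ext_less\<close> with the relations and the cuts exchanged,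
  so every fact about the extension is needed for one order only.\<close>

fun swap_cuts :: "'a ext_point \<Rightarrow> 'a ext_point" where
  "swap_cuts (Inl a) = Inl a"
| "swap_cuts (Inr (c, d, n)) = Inr (d, c, n)"

lemma support_swap_cuts [simp]: "support (swap_cuts z) = support z"
  by (induction z rule: swap_cuts.induct) auto

lemma swap_cuts_eq_iff [simp]: "swap_cuts z = swap_cuts w \<longleftrightarrow> z = w"
  by (induction z rule: swap_cuts.induct; induction w rule: swap_cuts.induct) auto

lemma support_move [simp]: "support (move f k z) = f ` support z"
  by (induction f k z rule: move.induct) (auto simp: option.set_map)

lemma move_move: "move f k (move g l z) = move (f \<circ> g) (k + l) z"
  by (induction g l z rule: move.induct) (auto simp: option.map_comp comp_def)

lemma move_cong: "(\<And>a. a \<in> support z \<Longrightarrow> f a = g a) \<Longrightarrow> k = l \<Longrightarrow> move f k z = move g l z"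
  by (induction g l z rule: move.induct) (auto intro!: option.map_cong)

lemma move_id: "(\<And>a. a \<in> support z \<Longrightarrow> f a = a) \<Longrightarrow> move f 0 z = z"
  by (induction f "0::int" z rule: move.induct) (auto intro!: option.map_ident_strong)

lemma swap_cuts_move: "swap_cuts (move f k z) = move f k (swap_cuts z)"
  by (induction f k z rule: move.induct) auto

section \<open>Strict linearity of the orders on cuts and points, and their preservation by
  maps\<close>

lemma cut_less_trans:
  assumes "transp R" "cut_less R a b" "cut_less R b c"
  shows "cut_less R a c"
  using assms by (cases a; cases b; cases c) (auto dest: transpD)

lemma cut_less_irrefl: "irreflp R \<Longrightarrow> \<not> cut_less R c c"
  by (cases c) (auto simp: irreflp_def)

lemma cut_less_total:
  assumes "totalp_on U R" "set_option a \<subseteq> U" "set_option b \<subseteq> U" "a \<noteq> b"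
  shows "cut_less R a b \<or> cut_less R b a"
  using assms by (cases a; cases b) (auto dest: totalp_onD)

lemma cut_less_map:
  assumes "\<And>x y. x \<in> U \<Longrightarrow> y \<in> U \<Longrightarrow> R' (f x) (f y) \<longleftrightarrow> R x y"
    and "set_option a \<subseteq> U" "set_option b \<subseteq> U"
  shows "cut_less R' (map_option f a) (map_option f b) \<longleftrightarrow> cut_less R a b"
  using assms by (cases a; cases b) auto

lemma ext_less_trans:
  assumes "transp R" "transp S" "ext_less R S x y" "ext_less R S y z"
  shows "ext_less R S x z"
proof -
  \<comment> \<open>Written this way, comparisons of old points are comparisons of cuts too, and
    transitivity of \<open>cut_less\<close> settles all cases.\<close>
  have R: "R a b \<longleftrightarrow> cut_less R (Some a) (Some b)" for a b
    by simp
  note trans = cut_less_trans[OF assms(1)] cut_less_trans[OF assms(2)] less_trans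
  show ?thesis
    using assms(3,4)
    by (cases x rule: support.cases; cases y rule: support.cases; cases z rule: support.cases;
        simp add: R del: cut_less.simps; metis trans)
qed

lemma ext_less_irrefl: "irreflp R \<Longrightarrow> irreflp S \<Longrightarrow> \<not> ext_less R S x x"
  by (cases x) (auto simp: cut_less_irrefl dest: irreflpD)

lemma ext_less_total:
  assumes "totalp_on U R" "totalp_on U S" "support x \<subseteq> U" "support y \<subseteq> U" "x \<noteq> y"
  shows "ext_less R S x y \<or> ext_less R S y x"
proof -
  have *: "cut_less R c d \<or> c = d \<or> cut_less R d c"
    "cut_less S c d \<or> c = d \<or> cut_less S d c"
    if "set_option c \<subseteq> U" "set_option d \<subseteq> U" for c d
    using cut_less_total[OF assms(1) that] cut_less_total[OF assms(2) that] by blast+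
  show ?thesis
  proof (cases x)
    case (Inl a)
    note x = this
    show ?thesis
    proof (cases y)
      case (Inl b)
      with x assms show ?thesis by (auto dest: totalp_onD)
    next
      case (Inr q)
      then show ?thesis
        using x assms(3,4) *(1)[of "Some a" "fst q"] by (cases q) auto
    qed
  next
    case (Inr p)
    note x = this
    show ?thesis
    proof (cases y)
      case (Inl b)
      then show ?thesis
        using x assms(3,4) *(1)[of "fst p" "Some b"] by (cases p) auto
    next
      case (Inr q)
      then show ?thesis
        using x assms(3-5) *(1)[of "fst p" "fst q"] *(2)[of "fst (snd p)" "fst (snd q)"]
        by (cases p; cases q) auto
    qed
  qed
qed

text \<open>Both integers grow by the same \<open>k\<close>, so their comparison is unchanged.
  Injectivity of \<open>f\<close> on \<open>U\<close> keeps distinct cuts distinct, which matters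
  for the tie-breaking clauses.\<close>

lemma ext_less_move:
  assumes R: "\<And>x y. x \<in> U \<Longrightarrow> y \<in> U \<Longrightarrow> R' (f x) (f y) \<longleftrightarrow> R x y"
    and S: "\<And>x y. x \<in> U \<Longrightarrow> y \<in> U \<Longrightarrow> S' (f x) (f y) \<longleftrightarrow> S x y"
    and f: "inj_on f U"
    and z: "support z \<subseteq> U" and w: "support w \<subseteq> U"
  shows "ext_less R' S' (move f k z) (move f k w) \<longleftrightarrow> ext_less R S z w"
proof -
  note cR = cut_less_map[of U R' f R, OF R]
  note cS = cut_less_map[of U S' f S, OF S]
  have eq: "map_option f c = map_option f d \<longleftrightarrow> c = d"
    if "set_option c \<subseteq> U" "set_option d \<subseteq> U" for c d
    using f that by (cases c; cases d) (auto dest: inj_onD)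
  show ?thesis
  proof (cases z)
    case (Inl a)
    note z' = this
    show ?thesis
    proof (cases w)
      case (Inl b)
      with z' z w show ?thesis by (simp add: R)
    next
      case (Inr q)
      then show ?thesis
        using z' z w cR[of "Some a" "fst q"] eq[of "Some a" "fst q"] by (cases q) auto
    qed
  next
    case (Inr p)
    note z' = this
    show ?thesis
    proof (cases w)
      case (Inl b)
      then show ?thesis
        using z' z w cR[of "fst p" "Some b"] by (cases p) auto
    next
      case (Inr q)
      then show ?thesis
        using z' z w cR[of "fst p" "fst q"] eq[of "fst p" "fst q"]
          cS[of "fst (snd p)" "fst (snd q)"] eq[of "fst (snd p)" "fst (snd q)"]
        by (cases p; cases q) auto
    qed
  qed
qed

section \<open>Cuts determined by finite lower sets\<close>

lemma finite_has_greatest: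
  assumes "finite S" "S \<noteq> {}" "transp R" "totalp_on S R"
  shows "\<exists>m\<in>S. \<forall>a\<in>S. a = m \<or> R a m"
  using assms(1,2,4)
proof (induction rule: finite_ne_induct)
  case (insert x S)
  have "totalp_on S R"
    using insert.prems by (rule totalp_on_subset) blast
  with insert.IH obtain m where m: "m \<in> S" "\<And>a. a \<in> S \<Longrightarrow> a = m \<or> R a m"
    by blast
  have "R m x \<or> R x m"
    using insert.prems insert.hyps m(1) by (metis insertI1 insertI2 totalp_onD)
  then show ?case
    using m transpD[OF \<open>transp R\<close>] by (metis insertE insertI1 insertI2)
qed simp

text \<open>The greatest element of \<open>S\<close> names the cut, and \<open>None\<close> serves
  for empty \<open>S\<close>. Because types have finitely many parameters, cuts of this simple form
  suffice to realize them.\<close>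

lemma cut_of_lower_set:
  assumes "finite S" "S \<subseteq> F" "transp R" "totalp_on F R"
    and low: "\<And>a b. a \<in> F \<Longrightarrow> b \<in> S \<Longrightarrow> R a b \<Longrightarrow> a \<in> S"
  shows "\<exists>c. set_option c \<subseteq> F \<and> (\<forall>a\<in>F. (a \<in> S \<longleftrightarrow> Some a = c \<or> cut_less R (Some a) c))"
proof (cases "S = {}")
  case True
  then show ?thesis by (intro exI[of _ None]) auto
next
  case False
  obtain m where "m \<in> S" "\<And>a. a \<in> S \<Longrightarrow> a = m \<or> R a m"
    using finite_has_greatest[OF assms(1) False assms(3)] totalp_on_subset[OF assms(4,2)] by blast
  then show ?thesis
    using low assms(2) by (intro exI[of _ "Some m"]) auto
qed

section \<open>Coding of points by natural numbers\<close>

definition point_code :: "nat ext_point \<Rightarrow> nat" where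
  "point_code = to_nat_on UNIV"

definition code_point :: "nat \<Rightarrow> nat ext_point" where
  "code_point = from_nat_into UNIV"

text \<open>On an infinite countable set \<open>to_nat_on\<close> is a bijection onto the natural
  numbers; this makes every number the code of a point.\<close>

lemma infinite_ext_points: "infinite (UNIV :: 'a ext_point set)"
proof
  assume "finite (UNIV :: 'a ext_point set)"
  then have "finite (range (\<lambda>n::int. Inr (None, None, n) :: 'a ext_point))"
    by (rule finite_subset[rotated]) simp
  then have "finite (UNIV :: int set)"
    by (rule finite_imageD) (auto simp: inj_on_def)
  then show False by (simp add: infinite_UNIV_int)
qed

lemma code_point_point_code [simp]: "code_point (point_code z) = z"
  unfolding code_point_def point_code_def by simp

lemma point_code_code_point [simp]: "point_code (code_point n) = n"
  unfolding code_point_def point_code_def using infinite_ext_points by simp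

lemma point_code_eq_iff [simp]: "point_code z = point_code w \<longleftrightarrow> z = w"
  by (metis code_point_point_code)

lemma code_point_eq_iff [simp]: "code_point m = code_point n \<longleftrightarrow> m = n"
  by (metis point_code_code_point)

section \<open>The extension as a structure, the inclusion and the induced maps\<close>

definition bin :: "olo_symbol struc \<Rightarrow> olo_symbol \<Rightarrow> nat \<Rightarrow> nat \<Rightarrow> bool" where
  "bin A r x y \<longleftrightarrow> rel A r [x, y]"

fun ext_rel :: "olo_symbol struc \<Rightarrow> olo_symbol \<Rightarrow> nat ext_point \<Rightarrow> nat ext_point \<Rightarrow> bool" where
  "ext_rel A Less z w \<longleftrightarrow> ext_less (bin A Less) (bin A Tri) z w"
| "ext_rel A Tri z w \<longleftrightarrow> ext_less (bin A Tri) (bin A Less) (swap_cuts z) (swap_cuts w)"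

text \<open>The coding of points does not depend on \<open>A\<close>; only the choice of the points
  in the universe does. Each coordinate of the result is therefore a simple condition on
  \<open>A\<close>, which gives Borel measurability. Over the empty structure one copy of the
  integers remains.\<close>

definition extension :: "olo_symbol struc \<Rightarrow> olo_symbol struc" where
  "extension A =
     (\<lambda>n. support (code_point n) \<subseteq> univ A,
      \<lambda>r ns. \<exists>z w. ns = [point_code z, point_code w] \<and>
        support z \<subseteq> univ A \<and> support w \<subseteq> univ A \<and> ext_rel A r z w)"

definition inclusion :: "olo_symbol struc \<Rightarrow> nat \<Rightarrow> nat" where
  "inclusion A = restrict (\<lambda>x. point_code (Inl x)) (univ A)"

definition induced :: "int \<Rightarrow> olo_symbol struc \<Rightarrow> (nat \<Rightarrow> nat) \<Rightarrow> nat \<Rightarrow> nat" where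
  "induced k A f =
     restrict (\<lambda>n. point_code (move f k (code_point n))) (univ (extension A))"

lemma mem_univ_extension [simp]: "n \<in> univ (extension A) \<longleftrightarrow> support (code_point n) \<subseteq> univ A"
  by (simp add: univ_def extension_def)

lemma rel_extension:
  "rel (extension A) r ns \<longleftrightarrow> (\<exists>z w. ns = [point_code z, point_code w] \<and>
     support z \<subseteq> univ A \<and> support w \<subseteq> univ A \<and> ext_rel A r z w)"
  by (simp add: rel_def extension_def)

lemma rel_extension_pair:
  "rel (extension A) r [m, n] \<longleftrightarrow> support (code_point m) \<subseteq> univ A \<and>
     support (code_point n) \<subseteq> univ A \<and> ext_rel A r (code_point m) (code_point n)"
proof
  assume "support (code_point m) \<subseteq> univ A \<and> support (code_point n) \<subseteq> univ A \<and>
    ext_rel A r (code_point m) (code_point n)"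
  then show "rel (extension A) r [m, n]"
    unfolding rel_extension by (intro exI[of _ "code_point m"] exI[of _ "code_point n"]) simp
qed (auto simp: rel_extension)

section \<open>Ordered linear orders through binary relations, and closure under isomorphism\<close>

lemma olo_iff:
  "A \<in> ordered_linear_orders \<longleftrightarrow> A \<in> structures olo_arity \<and>
     (\<forall>r. transp (bin A r) \<and> irreflp (bin A r) \<and> totalp_on (univ A) (bin A r))"
proof -
  have "strict_linear_order_on (univ A) {(x, y). rel A r [x, y]} \<longleftrightarrow>
     transp (bin A r) \<and> irreflp (bin A r) \<and> totalp_on (univ A) (bin A r)" for r
    unfolding strict_linear_order_on_def bin_def
    by (auto simp: trans_def transp_def irrefl_def irreflp_def total_on_def totalp_on_def)
  moreover have "(\<forall>r. P r) \<longleftrightarrow> P Less \<and> P Tri" for P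
    by (metis olo_symbol.exhaust)
  ultimately show ?thesis
    unfolding ordered_linear_orders_def by simp
qed

lemma olo_bin:
  assumes "A \<in> ordered_linear_orders"
  shows "transp (bin A r)" "irreflp (bin A r)" "totalp_on (univ A) (bin A r)"
  using assms by (auto simp: olo_iff)

lemma structures_rel_iff:
  assumes "A \<in> structures olo_arity"
  shows "rel A r xs \<longleftrightarrow> (\<exists>x y. xs = [x, y] \<and> x \<in> univ A \<and> y \<in> univ A \<and> bin A r x y)"
proof
  assume *: "rel A r xs"
  then have "length xs = 2" "set xs \<subseteq> univ A"
    using assms unfolding structures_def olo_arity_def by auto
  then show "\<exists>x y. xs = [x, y] \<and> x \<in> univ A \<and> y \<in> univ A \<and> bin A r x y"
    using * by (auto simp: bin_def length_Suc_conv numeral_2_eq_2)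
qed (auto simp: bin_def)

lemma embeddings_iff:
  assumes "A \<in> structures olo_arity" "B \<in> structures olo_arity"
  shows "f \<in> embeddings A B \<longleftrightarrow> f \<in> univ A \<rightarrow>\<^sub>E univ B \<and> inj_on f (univ A) \<and>
     (\<forall>r. \<forall>x\<in>univ A. \<forall>y\<in>univ A. bin B r (f x) (f y) \<longleftrightarrow> bin A r x y)"
proof -
  have "(\<forall>xs. set xs \<subseteq> univ A \<longrightarrow> (rel A r xs \<longleftrightarrow> rel B r (map f xs))) \<longleftrightarrow>
    (\<forall>x\<in>univ A. \<forall>y\<in>univ A. bin B r (f x) (f y) \<longleftrightarrow> bin A r x y)"
    (is "?l \<longleftrightarrow> ?r") if f: "f \<in> univ A \<rightarrow>\<^sub>E univ B" for r
  proof
    assume ?l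
    then show ?r
      by (simp add: bin_def)
  next
    assume r: ?r
    show ?l
      unfolding structures_rel_iff[OF assms(1)] structures_rel_iff[OF assms(2)]
      using r f by (auto simp: map_eq_Cons_conv PiE_iff)
  qed
  then show ?thesis
    unfolding embeddings_def by blast
qed

lemma olo_iso_closed: "iso_closed olo_arity ordered_linear_orders"
  unfolding iso_closed_def
proof (intro ballI impI)
  fix A B
  assume A: "A \<in> ordered_linear_orders" and B: "B \<in> structures olo_arity" and "isos A B \<noteq> {}"
  then obtain f where f: "f \<in> embeddings A B" "f ` univ A = univ B"
    unfolding isos_def by blast
  have A': "A \<in> structures olo_arity"
    using A by (simp add: olo_iff)
  have inj: "inj_on f (univ A)"
    and r: "\<And>r x y. x \<in> univ A \<Longrightarrow> y \<in> univ A \<Longrightarrow> bin B r (f x) (f y) \<longleftrightarrow> bin A r x y"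
    using f(1) unfolding embeddings_iff[OF A' B] by auto
  \<comment> \<open>The relations of \<open>B\<close> hold only inside its universe, which
    \<open>f\<close> covers, so every related pair comes from a related pair of
    \<open>A\<close>.\<close>
  have img: "\<exists>x\<in>univ A. \<exists>y\<in>univ A. u = f x \<and> v = f y \<and> bin A r x y" if "bin B r u v" for r u v
  proof -
    have "u \<in> univ B" "v \<in> univ B"
      using B that unfolding bin_def structures_def by fastforce+
    then obtain x y where "x \<in> univ A" "y \<in> univ A" "u = f x" "v = f y"
      unfolding f(2)[symmetric] by blast
    then show ?thesis
      using that r by blast
  qed
  have "transp (bin B r)" for r
  proof (rule transpI)
    fix u v w
    assume "bin B r u v" "bin B r v w"
    then obtain x y y' z where "x \<in> univ A" "y \<in> univ A" "y' \<in> univ A" "z \<in> univ A"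
      "u = f x" "v = f y" "bin A r x y" "v = f y'" "w = f z" "bin A r y' z"
      using img by metis
    then show "bin B r u w"
      using r inj olo_bin(1)[OF A, of r] by (metis inj_onD transpD)
  qed
  moreover have "irreflp (bin B r)" for r
  proof (rule irreflpI)
    fix u
    show "\<not> bin B r u u"
    proof
      assume "bin B r u u"
      then obtain x y where "x \<in> univ A" "y \<in> univ A" "f x = f y" "bin A r x y"
        using img by metis
      then show False
        using inj_onD[OF inj] irreflpD[OF olo_bin(2)[OF A]] by metis
    qed
  qed
  moreover have "totalp_on (univ B) (bin B r)" for r
    using r olo_bin(3)[OF A, of r] unfolding f(2)[symmetric] totalp_on_def by auto
  ultimately show "B \<in> ordered_linear_orders"
    using B by (simp add: olo_iff)
qed

section \<open>The extension is an ordered linear order, and isomorphisms act on it\<close>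

lemma bin_extension:
  "bin (extension A) r m n \<longleftrightarrow> support (code_point m) \<subseteq> univ A \<and>
     support (code_point n) \<subseteq> univ A \<and> ext_rel A r (code_point m) (code_point n)"
  by (simp add: bin_def rel_extension_pair)

lemma extension_in_structures: "extension A \<in> structures olo_arity"
  unfolding structures_def by (auto simp: olo_arity_def rel_extension subset_iff)

lemma extension_in_olo:
  assumes "A \<in> ordered_linear_orders"
  shows "extension A \<in> ordered_linear_orders"
proof -
  note A = olo_bin[OF assms]
  have "ext_rel A r x z" if "ext_rel A r x y" "ext_rel A r y z" for r x y z
    using that by (cases r) (auto intro: ext_less_trans A)
  then have "transp (bin (extension A) r)" for r
    unfolding transp_def bin_extension by blast
  moreover have "\<not> ext_rel A r x x" for r x
    by (cases r) (auto simp: ext_less_irrefl A)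
  then have "irreflp (bin (extension A) r)" for r
    unfolding irreflp_def bin_extension by blast
  moreover have "ext_rel A r x y \<or> ext_rel A r y x"
    if "support x \<subseteq> univ A" "support y \<subseteq> univ A" "x \<noteq> y" for r x y
    using that ext_less_total[OF A(3) A(3)] by (cases r) auto
  then have "totalp_on (univ (extension A)) (bin (extension A) r)" for r
    unfolding totalp_on_def bin_extension by simp
  ultimately show ?thesis
    by (simp add: olo_iff extension_in_structures)
qed

lemma inclusion_embedding:
  assumes "A \<in> structures olo_arity"
  shows "inclusion A \<in> embeddings A (extension A)"
proof -
  have "ext_rel A r (Inl x) (Inl y) \<longleftrightarrow> bin A r x y" for r x y
    by (cases r) auto
  then show ?thesis
    unfolding embeddings_iff[OF assms extension_in_structures]
    by (auto simp: inclusion_def bin_extension inj_on_def)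
qed

lemma induced_iso:
  assumes A: "A \<in> structures olo_arity" and B: "B \<in> structures olo_arity" and f: "f \<in> isos A B"
  shows "induced k A f \<in> isos (extension A) (extension B)"
proof -
  have "f \<in> embeddings A B" and im: "f ` univ A = univ B"
    using f by (auto simp: isos_def)
  then have inj: "inj_on f (univ A)"
    and r: "\<And>r x y. x \<in> univ A \<Longrightarrow> y \<in> univ A \<Longrightarrow> bin B r (f x) (f y) \<longleftrightarrow> bin A r x y"
    unfolding embeddings_iff[OF A B] by auto
  \<comment> \<open>Moving along the inverse \<open>g\<close> with the opposite shift
    \<open>- k\<close> inverts \<open>move f k\<close>; this yields injectivity and surjectivity of
    the induced map.\<close>
  define g where "g = inv_into (univ A) f"
  have g: "\<And>x. x \<in> univ A \<Longrightarrow> g (f x) = x" "\<And>y. y \<in> univ B \<Longrightarrow> f (g y) = y"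
    "\<And>y. y \<in> univ B \<Longrightarrow> g y \<in> univ A"
    unfolding g_def im[symmetric] by (simp_all add: inj f_inv_into_f inv_into_into)
  have left: "move g (- k) (move f k z) = z" if "support z \<subseteq> univ A" for z
    unfolding move_move using that g(1) by (auto intro!: move_id)
  have right: "move f k (move g (- k) w) = w" if "support w \<subseteq> univ B" for w
    unfolding move_move using that g(2) by (auto intro!: move_id)
  have rel: "ext_rel B r (move f k z) (move f k w) \<longleftrightarrow> ext_rel A r z w"
    if "support z \<subseteq> univ A" "support w \<subseteq> univ A" for r z w
  proof -
    have "ext_less (bin B p) (bin B q) (move f k x) (move f k y) \<longleftrightarrow>
      ext_less (bin A p) (bin A q) x y" if "support x \<subseteq> univ A" "support y \<subseteq> univ A" for p q x y
      using inj that by (intro ext_less_move) (auto simp: r)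
    then show ?thesis
      using that by (cases r) (simp_all add: swap_cuts_move)
  qed
  have map: "support (move f k z) \<subseteq> univ B" if "support z \<subseteq> univ A" for z
    using that im by auto
  have "induced k A f \<in> embeddings (extension A) (extension B)"
    unfolding embeddings_iff[OF extension_in_structures extension_in_structures]
  proof (intro conjI allI ballI)
    show "induced k A f \<in> univ (extension A) \<rightarrow>\<^sub>E univ (extension B)"
      using map by (auto simp: induced_def)
    show "inj_on (induced k A f) (univ (extension A))"
      by (rule inj_onI) (simp add: induced_def, metis left code_point_eq_iff)
    fix r x y
    assume "x \<in> univ (extension A)" "y \<in> univ (extension A)"
    then show "bin (extension B) r (induced k A f x) (induced k A f y) \<longleftrightarrow> bin (extension A) r x y"
      using map rel by (auto simp: induced_def bin_extension)
  qed
  moreover have "n \<in> induced k A f ` univ (extension A)" if "n \<in> univ (extension B)" for n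
  proof (rule image_eqI)
    show "point_code (move g (- k) (code_point n)) \<in> univ (extension A)"
      using that g(3) by auto
    then show "n = induced k A f (point_code (move g (- k) (code_point n)))"
      using that right by (simp add: induced_def)
  qed
  ultimately show ?thesis
    unfolding isos_def by (auto simp: embeddings_def PiE_iff)
qed

section \<open>Realization of admissible types\<close>

lemma sat_transfer:
  assumes "A \<in> structures olo_arity" "B \<in> structures olo_arity" "C \<in> structures olo_arity"
    and j: "j \<in> embeddings A B" and i: "i \<in> embeddings A C" and F: "F \<subseteq> univ A"
    and bb: "\<And>r. bin B r b b \<longleftrightarrow> bin C r c c"
    and eq: "\<And>a. a \<in> F \<Longrightarrow> j a = b \<longleftrightarrow> i a = c"
    and less: "\<And>r a. a \<in> F \<Longrightarrow> bin B r (j a) b \<longleftrightarrow> bin C r (i a) c"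
    and greater: "\<And>r a. a \<in> F \<Longrightarrow> bin B r b (j a) \<longleftrightarrow> bin C r c (i a)"
    and p: "formula_over olo_arity F p"
  shows "sat B j b p \<longleftrightarrow> sat C i c p"
  using p
proof (induction p)
  case (Eq s t)
  \<comment> \<open>Atoms among parameters have the same truth value in \<open>B\<close> and
    \<open>C\<close>, since both embed \<open>A\<close>; atoms involving the free variable are
    covered by the hypotheses on \<open>b\<close> and \<open>c\<close>.\<close>
  have "j x = j y \<longleftrightarrow> i x = i y" if "x \<in> F" "y \<in> F" for x y
    using that F i j by (auto simp: embeddings_def dest: inj_onD)
  then show ?case
    using Eq eq by (cases s; cases t) (simp, auto)
next
  case (Atom r ts)
  then obtain s t where ts: "ts = [s, t]"
    by (auto simp: olo_arity_def length_Suc_conv numeral_2_eq_2)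
  have "bin B r (j x) (j y) \<longleftrightarrow> bin C r (i x) (i y)" if "x \<in> F" "y \<in> F" for x y
    using that F i j assms(1-3) by (simp add: embeddings_iff subset_iff)
  then show ?case
    using Atom ts bb less greater by (cases s; cases t) (auto simp flip: bin_def)
qed auto

text \<open>A realization \<open>b\<close> in some \<open>B\<close> is either a parameter, whose old
  copy then realizes the type, or it determines a cut of \<open>F\<close> in each order, and a new
  point filling both cuts has the same atomic relations to \<open>F\<close>.\<close>

lemma realizes_admissible_types:
  assumes A: "A \<in> ordered_linear_orders"
    and \<tau>: "\<tau> \<in> admissible_types olo_arity ordered_linear_orders A"
  shows "realized (extension A) (inclusion A) \<tau>"
proof -
  obtain F B j b where F: "finite F" "F \<subseteq> univ A" "\<And>p. p \<in> \<tau> \<Longrightarrow> formula_over olo_arity F p"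
    and B: "B \<in> ordered_linear_orders" and j: "j \<in> embeddings A B"
    and b: "b \<in> univ B" "\<And>p. p \<in> \<tau> \<Longrightarrow> sat B j b p"
    using \<tau> by (auto simp: admissible_types_def finite_types_def realized_def)
  have A': "A \<in> structures olo_arity" and B': "B \<in> structures olo_arity"
    using A B by (auto simp: olo_iff)
  note E = extension_in_olo[OF A] and i = inclusion_embedding[OF A']
  have j_rel: "\<And>r x y. x \<in> univ A \<Longrightarrow> y \<in> univ A \<Longrightarrow> bin B r (j x) (j y) \<longleftrightarrow> bin A r x y"
    and j_inj: "inj_on j (univ A)" and j_in: "\<And>x. x \<in> univ A \<Longrightarrow> j x \<in> univ B"
    using j unfolding embeddings_iff[OF A' B'] by auto
  have i_rel: "\<And>r x y. x \<in> univ A \<Longrightarrow> y \<in> univ A \<Longrightarrow>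
      bin (extension A) r (inclusion A x) (inclusion A y) \<longleftrightarrow> bin A r x y"
    and i_inj: "inj_on (inclusion A) (univ A)"
    and i_in: "\<And>x. x \<in> univ A \<Longrightarrow> inclusion A x \<in> univ (extension A)"
    using i unfolding embeddings_iff[OF A' extension_in_structures] by blast+
  have irrefl: "\<not> bin B r x x" "\<not> bin (extension A) r x x" for r x
    using olo_bin(2)[OF B, of r] olo_bin(2)[OF E, of r] by (auto dest: irreflpD)
  note transfer = sat_transfer[OF A' B' extension_in_structures j i F(2) _ _ _ _ F(3)]
  show ?thesis
  \<comment> \<open>Only the parameters in \<open>F\<close> matter: if \<open>b\<close> is the image
    of an element of \<open>A\<close> outside \<open>F\<close>, a new point replaces it.\<close>
  proof (cases "\<exists>a\<in>F. b = j a")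
    case True
    then obtain a where a: "a \<in> F" "b = j a" by blast
    then have aA: "a \<in> univ A" using F(2) by blast
    have "sat (extension A) (inclusion A) (inclusion A a) p" if "p \<in> \<tau>" for p
    proof (subst transfer[OF _ _ _ _ that, symmetric])
      fix x
      assume "x \<in> F"
      then have "x \<in> univ A" using F(2) by blast
      then show "j x = b \<longleftrightarrow> inclusion A x = inclusion A a"
        using a aA i_inj j_inj by (auto dest: inj_onD)
    qed (use a aA F(2) b(2)[OF that] in
        \<open>auto simp: i_in irrefl j_rel i_rel subset_iff simp del: mem_univ_extension\<close>)
    then show ?thesis
      using i_in[OF aA] unfolding realized_def by blast
  next
    case False
    \<comment> \<open>The parameters below \<open>b\<close> form a finite lower set of
      \<open>F\<close>.\<close>
    have cut: "\<exists>c. set_option c \<subseteq> F \<and>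
      (\<forall>a\<in>F. (bin B r (j a) b \<longleftrightarrow> Some a = c \<or> cut_less (bin A r) (Some a) c))" for r
    proof -
      have "\<exists>c. set_option c \<subseteq> F \<and> (\<forall>a\<in>F. (a \<in> {a\<in>F. bin B r (j a) b} \<longleftrightarrow>
        Some a = c \<or> cut_less (bin A r) (Some a) c))"
      proof (rule cut_of_lower_set)
        show "totalp_on F (bin A r)"
          using olo_bin(3)[OF A] F(2) by (rule totalp_on_subset)
        fix x y
        assume "x \<in> F" "y \<in> {a\<in>F. bin B r (j a) b}" "bin A r x y"
        then show "x \<in> {a\<in>F. bin B r (j a) b}"
          using F(2) j_rel transpD[OF olo_bin(1)[OF B, of r]]
          by (metis (mono_tags, lifting) mem_Collect_eq subsetD)
      qed (use F(1) olo_bin(1)[OF A] in auto)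
      then show ?thesis by simp
    qed
    obtain c where c: "set_option c \<subseteq> F" "\<And>a. a \<in> F \<Longrightarrow>
      bin B Less (j a) b \<longleftrightarrow> Some a = c \<or> cut_less (bin A Less) (Some a) c"
      using cut by blast
    obtain d where d: "set_option d \<subseteq> F" "\<And>a. a \<in> F \<Longrightarrow>
      bin B Tri (j a) b \<longleftrightarrow> Some a = d \<or> cut_less (bin A Tri) (Some a) d"
      using cut by blast
    \<comment> \<open>The type sees only the two cuts, so any integer would do in place of
      0.\<close>
    define e where "e = point_code (Inr (c, d, 0))"
    have e: "e \<in> univ (extension A)"
      using c(1) d(1) F(2) by (auto simp: e_def)
    have neq: "inclusion A a \<noteq> e" "j a \<noteq> b" if "a \<in> F" for a
      using that F(2) False by (auto simp: e_def inclusion_def)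
    have less: "bin B r (j a) b \<longleftrightarrow> bin (extension A) r (inclusion A a) e" if "a \<in> F" for r a
      using that c d F(2) by (cases r) (auto simp: e_def inclusion_def bin_extension subset_iff)
    have greater: "bin B r b (j a) \<longleftrightarrow> bin (extension A) r e (inclusion A a)"
      if "a \<in> F" for r a
    proof -
      \<comment> \<open>As \<open>b\<close> differs from all parameters, totality makes each
        relation above \<open>b\<close> the negation of one below it; the same holds for
        \<open>e\<close>.\<close>
      have "bin B r b (j a) \<longleftrightarrow> \<not> bin B r (j a) b"
        using olo_bin[OF B, of r] neq(2)[OF that] b(1) j_in that F(2) irrefl(1)
        by (metis subsetD totalp_onD transpD)
      moreover have "bin (extension A) r e (inclusion A a) \<longleftrightarrow>
          \<not> bin (extension A) r (inclusion A a) e"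
        using olo_bin[OF E, of r] neq(1)[OF that] e i_in that F(2) irrefl(2)
        by (metis subsetD totalp_onD transpD)
      ultimately show ?thesis
        using less[OF that] by blast
    qed
    have "sat (extension A) (inclusion A) e p" if "p \<in> \<tau>" for p
      using transfer[OF _ _ less greater that] b(2)[OF that] irrefl neq by simp
    then show ?thesis
      using e unfolding realized_def by blast
  qed
qed

section \<open>Borel measurability\<close>

lemma borel_measurable_countable_iff:
  fixes f :: "'a \<Rightarrow> 'b :: {countable, t2_space}"
  shows "f \<in> borel_measurable M \<longleftrightarrow> f \<in> M \<rightarrow>\<^sub>M count_space UNIV"
proof -
  \<comment> \<open>Points are closed in a Hausdorff space, so in a countable one every set is
    Borel.\<close>
  have "borel_measurable M = M \<rightarrow>\<^sub>M (count_space UNIV :: 'b measure)"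
    by (rule measurable_cong_sets) (simp_all add: sets_borel_eq_count_space)
  then show ?thesis by simp
qed

lemma fst_borel_measurable: "fst \<in> borel \<rightarrow>\<^sub>M borel"
  by (intro borel_measurable_continuous_onI continuous_intros)

lemma snd_borel_measurable: "snd \<in> borel \<rightarrow>\<^sub>M borel"
  by (intro borel_measurable_continuous_onI continuous_intros)

lemma pred_univ [measurable]: "Measurable.pred borel (\<lambda>A :: 'r struc. n \<in> univ A)"
proof -
  have "(\<lambda>A :: 'r struc. fst A n) \<in> borel_measurable borel"
    by (rule measurable_compose[OF fst_borel_measurable measurable_product_coordinates])
  then show ?thesis
    unfolding borel_measurable_countable_iff by (simp add: univ_def)
qed

lemma pred_rel [measurable]: "Measurable.pred borel (\<lambda>A :: 'r struc. rel A r xs)"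
proof -
  have "(\<lambda>A :: 'r struc. snd A r xs) \<in> borel_measurable borel"
    by (rule measurable_compose[OF measurable_compose[OF snd_borel_measurable
          measurable_product_coordinates] measurable_product_coordinates])
  then show ?thesis
    unfolding borel_measurable_countable_iff by (simp add: rel_def)
qed

lemma pred_bin [measurable]: "Measurable.pred borel (\<lambda>A. bin A r x y)"
  unfolding bin_def by measurable

text \<open>The axioms quantify only over numbers, finite lists and relation symbols, all countable,
  so they are countable Boolean combinations of coordinate conditions.\<close>

lemma sets_olo: "ordered_linear_orders \<in> sets borel"
proof -
  have "Measurable.pred borel (\<lambda>A.
    (\<forall>r xs. rel A r xs \<longrightarrow> length xs = olo_arity r \<and> (\<forall>x. x \<in> set xs \<longrightarrow> x \<in> univ A)) \<and>
    (\<forall>r. (\<forall>x y z. bin A r x y \<longrightarrow> bin A r y z \<longrightarrow> bin A r x z) \<and> (\<forall>x. \<not> bin A r x x) \<and>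
      (\<forall>x y. x \<in> univ A \<longrightarrow> y \<in> univ A \<longrightarrow> x \<noteq> y \<longrightarrow> bin A r x y \<or> bin A r y x)))"
    by measurable
  also have "(\<lambda>A.
    (\<forall>r xs. rel A r xs \<longrightarrow> length xs = olo_arity r \<and> (\<forall>x. x \<in> set xs \<longrightarrow> x \<in> univ A)) \<and>
    (\<forall>r. (\<forall>x y z. bin A r x y \<longrightarrow> bin A r y z \<longrightarrow> bin A r x z) \<and> (\<forall>x. \<not> bin A r x x) \<and>
      (\<forall>x y. x \<in> univ A \<longrightarrow> y \<in> univ A \<longrightarrow> x \<noteq> y \<longrightarrow> bin A r x y \<or> bin A r y x))) =
    (\<lambda>A. A \<in> ordered_linear_orders)"
    unfolding olo_iff structures_def transp_def irreflp_def totalp_on_def subset_iff Ball_def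
    by (simp add: fun_eq_iff)
  finally show ?thesis
    by (simp add: pred_def)
qed

text \<open>A support has at most two elements, so this is a finite conjunction of coordinate
  conditions.\<close>

lemma pred_support: "Measurable.pred borel (\<lambda>A. support z \<subseteq> univ A)"
proof (cases z rule: support.cases)
  case (2 c d n)
  then show ?thesis by (cases c; cases d) simp_all
qed simp

lemma pred_cut_less:
  assumes "\<And>x y. Measurable.pred M (\<lambda>A. R A x y)"
  shows "Measurable.pred M (\<lambda>A. cut_less (R A) c d)"
  using assms by (cases c; cases d) simp_all

lemma pred_ext_less:
  assumes R [measurable]: "\<And>x y. Measurable.pred M (\<lambda>A. R A x y)"
    and S [measurable]: "\<And>x y. Measurable.pred M (\<lambda>A. S A x y)"
  shows "Measurable.pred M (\<lambda>A. ext_less (R A) (S A) z w)"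
proof -
  note [measurable] = pred_cut_less[where R = R, OF R] pred_cut_less[where R = S, OF S]
  show ?thesis
    by (cases z rule: support.cases; cases w rule: support.cases)
      (simp_all del: cut_less.simps)
qed

lemma pred_ext_rel: "Measurable.pred borel (\<lambda>A. ext_rel A r z w)"
  by (cases r) (simp_all add: pred_ext_less)

lemma borel_measurable_extension: "extension \<in> borel_measurable borel"
proof -
  note [measurable] = pred_support pred_ext_rel
  have "Measurable.pred borel (\<lambda>A. support (code_point n) \<subseteq> univ A)" for n
    by measurable
  moreover have "Measurable.pred borel (\<lambda>A. \<exists>z w. ns = [point_code z, point_code w] \<and>
        support z \<subseteq> univ A \<and> support w \<subseteq> univ A \<and> ext_rel A r z w)" for r ns
    by measurable
  ultimately show ?thesis
    unfolding extension_def
    by (intro borel_measurable_Pair measurable_coordinatewise_then_product)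
      (simp_all add: borel_measurable_countable_iff)
qed

lemma borel_measurable_inclusion: "inclusion \<in> borel_measurable borel"
proof (rule measurable_coordinatewise_then_product)
  fix x
  have "(\<lambda>A. if x \<in> univ A then point_code (Inl x) else undefined) \<in> borel_measurable borel"
    by measurable
  then show "(\<lambda>A. inclusion A x) \<in> borel_measurable borel"
    by (simp add: inclusion_def restrict_def)
qed

text \<open>For a fixed point \<open>z\<close> the result depends on the values of the map at the
  elements of the support only, that is, on at most two coordinates with countably many
  values.\<close>

lemma borel_measurable_move:
  "(\<lambda>p. point_code (move (snd p) k z)) \<in> (borel :: ('r struc \<times> (nat \<Rightarrow> nat)) measure) \<rightarrow>\<^sub>M borel"
proof -
  let ?M = "borel :: ('r struc \<times> (nat \<Rightarrow> nat)) measure"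
  have coord: "(\<lambda>p. snd p a) \<in> ?M \<rightarrow>\<^sub>M count_space UNIV" for a
    unfolding borel_measurable_countable_iff[symmetric]
    by (rule measurable_compose[OF snd_borel_measurable measurable_product_coordinates])
  show ?thesis
  proof (cases z rule: support.cases)
    case (1 a)
    have "(\<lambda>p. point_code (Inl (snd p a))) \<in> ?M \<rightarrow>\<^sub>M borel"
      by (rule measurable_compose[OF coord, where g = "\<lambda>m. point_code (Inl m)"]) simp
    then show ?thesis
      unfolding 1 move.simps .
  next
    case (2 c d n)
    have cut: "(\<lambda>p. map_option (snd p) e) \<in> ?M \<rightarrow>\<^sub>M count_space UNIV" for e
    proof (cases e)
      case (Some a)
      show ?thesis
        unfolding Some option.map by (rule measurable_compose[OF coord, where g = Some]) simp
    qed simp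
    \<comment> \<open>The two cuts vary one at a time: the second is first frozen as
      \<open>v\<close>, then its countably many values are patched together.\<close>
    have "(\<lambda>p. point_code (Inr (map_option (snd p) c, v, n + k))) \<in> ?M \<rightarrow>\<^sub>M borel" for v
      by (rule measurable_compose[OF cut, where g = "\<lambda>u. point_code (Inr (u, v, n + k))"]) simp
    then have "(\<lambda>p. point_code (Inr (map_option (snd p) c, map_option (snd p) d, n + k))) \<in> ?M \<rightarrow>\<^sub>M borel"
      by (rule measurable_compose_countable[OF _ cut])
    then show ?thesis
      unfolding 2 move.simps .
  qed
qed

lemma borel_measurable_induced: "(\<lambda>(A, f). induced k A f) \<in> borel_measurable borel"
proof (rule measurable_coordinatewise_then_product)
  fix n
  have "Measurable.pred borel (\<lambda>p :: olo_symbol struc \<times> (nat \<Rightarrow> nat). support (code_point n) \<subseteq> univ (fst p))"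
    by (rule measurable_compose[OF fst_borel_measurable pred_support])
  then have "(\<lambda>p :: olo_symbol struc \<times> (nat \<Rightarrow> nat). if support (code_point n) \<subseteq> univ (fst p)
     then point_code (move (snd p) k (code_point n)) else undefined) \<in> borel_measurable borel"
    by (intro measurable_If borel_measurable_move measurable_const) (simp_all add: pred_def)
  then show "(\<lambda>p. (case p of (A, f) \<Rightarrow> induced k A f) n) \<in> borel_measurable borel"
    by (simp add: induced_def restrict_def case_prod_beta)
qed

section \<open>Extension, absence of new fixed points, and equivariance of the induced maps\<close>

lemma induced_inclusion:
  assumes "x \<in> univ A" "f x \<in> univ B"
  shows "induced k A f (inclusion A x) = inclusion B (f x)"
  using assms by (simp add: induced_def inclusion_def)

text \<open>A point outside the image of the inclusion carries an integer, and that integer changes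
  by \<open>k\<close>, whatever happens to the cuts.\<close>

lemma induced_moves_new_points:
  assumes "y \<in> univ (extension A) - inclusion A ` univ A" "k \<noteq> 0"
  shows "induced k A f y \<noteq> y"
proof (cases "code_point y" rule: support.cases)
  case (1 a)
  then have "y = point_code (Inl a)" "a \<in> univ A"
    using assms(1) by (metis point_code_code_point, simp)
  then have "y \<in> inclusion A ` univ A"
    by (auto simp: inclusion_def)
  then show ?thesis using assms(1) by blast
next
  case (2 c d n)
  then have "code_point (induced k A f y) \<noteq> code_point y"
    using assms by (simp add: induced_def)
  then show ?thesis by auto
qed

text \<open>Composing moves composes the maps and adds the shifts, and addition of integers is
  commutative.\<close>

lemma induced_commute:
  assumes "\<phi> \<in> univ A \<rightarrow> univ A" "\<alpha> \<in> univ A \<rightarrow> univ B"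
    and "\<And>x. x \<in> univ A \<Longrightarrow> \<alpha> (\<phi> x) = \<psi> (\<alpha> x)" and y: "y \<in> univ (extension A)"
  shows "induced l A \<alpha> (induced k A \<phi> y) = induced k B \<psi> (induced l A \<alpha> y)"
proof -
  have "support (move \<phi> k (code_point y)) \<subseteq> univ A" "support (move \<alpha> l (code_point y)) \<subseteq> univ B"
    using y assms(1,2) by auto
  moreover have "move (\<alpha> \<circ> \<phi>) (l + k) (code_point y) = move (\<psi> \<circ> \<alpha>) (k + l) (code_point y)"
    using y assms(3) by (intro move_cong) auto
  ultimately show ?thesis
    using y by (simp add: induced_def move_move)
qed

lemma isos_funcset: "f \<in> isos A B \<Longrightarrow> f \<in> univ A \<rightarrow> univ B"
  by (auto simp: isos_def embeddings_def)

theorem theorem3p2: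
  shows "ABAP olo_arity ordered_linear_orders"
proof -
  let ?K = ordered_linear_orders
  have K: "?K \<subseteq> structures olo_arity"
    by (auto simp: olo_iff)
  have "borel_extension olo_arity ?K extension inclusion"
    unfolding borel_extension_def
    using K by (auto simp: measurable_restrict_space1 borel_measurable_extension
        borel_measurable_inclusion extension_in_olo inclusion_embedding realizes_admissible_types)
  moreover have "borel_aut_extension ?K extension inclusion (induced 1)"
    unfolding borel_aut_extension_def
  proof (intro conjI ballI)
    show "(\<lambda>(A, \<phi>). induced 1 A \<phi>) \<in>
        restrict_space borel {(A, \<phi>). A \<in> ?K \<and> \<phi> \<in> auts A} \<rightarrow>\<^sub>M borel"
      by (intro measurable_restrict_space1 borel_measurable_induced)
    fix A \<phi>
    assume "A \<in> ?K" and \<phi>: "\<phi> \<in> auts A"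
    then show "induced 1 A \<phi> \<in> auts (extension A)"
      using K by (blast intro: induced_iso)
    show "induced 1 A \<phi> (inclusion A x) = inclusion A (\<phi> x)" if "x \<in> univ A" for x
      using that isos_funcset[OF \<phi>] by (intro induced_inclusion) auto
    show "induced 1 A \<phi> y \<noteq> y" if "y \<in> univ (extension A) - inclusion A ` univ A" for y
      using that by (rule induced_moves_new_points) simp
  qed
  \<comment> \<open>Isomorphisms are extended with shift 0 and automorphisms with shift 1, so both
    sides of the equivariance condition have total shift 1.\<close>
  moreover have "equivariant_iso_extension ?K extension inclusion (induced 1) (\<lambda>A _. induced 0 A)"
    unfolding equivariant_iso_extension_def
  proof (intro ballI conjI impI)
    fix A\<^sub>0 A\<^sub>1 \<alpha>
    assume "A\<^sub>0 \<in> ?K" "A\<^sub>1 \<in> ?K" and \<alpha>: "\<alpha> \<in> isos A\<^sub>0 A\<^sub>1"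
    then show "induced 0 A\<^sub>0 \<alpha> \<in> isos (extension A\<^sub>0) (extension A\<^sub>1)"
      using K by (blast intro: induced_iso)
    show "induced 0 A\<^sub>0 \<alpha> (inclusion A\<^sub>0 x) = inclusion A\<^sub>1 (\<alpha> x)" if "x \<in> univ A\<^sub>0" for x
      using that isos_funcset[OF \<alpha>] by (intro induced_inclusion) auto
    fix \<phi>\<^sub>0 \<phi>\<^sub>1 y
    assume "\<phi>\<^sub>0 \<in> auts A\<^sub>0" and comm: "\<forall>x\<in>univ A\<^sub>0. \<alpha> (\<phi>\<^sub>0 x) = \<phi>\<^sub>1 (\<alpha> x)"
      and y: "y \<in> univ (extension A\<^sub>0)"
    then show "induced 0 A\<^sub>0 \<alpha> (induced 1 A\<^sub>0 \<phi>\<^sub>0 y) = induced 1 A\<^sub>1 \<phi>\<^sub>1 (induced 0 A\<^sub>0 \<alpha> y)"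
      by (intro induced_commute isos_funcset[OF \<alpha>] isos_funcset) auto
  qed
  ultimately show ?thesis
    unfolding ABAP_def using K olo_iso_closed sets_olo by blast
qed

end
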